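(* Let $T=(V,E)$ be a tree on $n$ vertices whose edges carry nonsingular real matrix weights of order $s\times s$, let $L$ be the Laplacian matrix of $T$, and let $L^{+}$ be its Moore–Penrose inverse. For $v\in V$, let $L_v$ and $(L^{+})_v$ be the principal submatrices of $L$ and $L^{+}$, respectively, obtained by deleting the row block and column block corresponding to $v$. Then $$(L^{+})_v=M\,L_v^{-1}M,\qquad\text{where } M=I_{(n-1)s}-J_{n-1}\otimes \tfrac1n I_s .$$ Moreover, if $V=\{v_1,\dots,v_n\}$ is the ordering of the vertices in $L$ and $v=v_n$, then $$L^{+}=\begin{bmatrix}\mathbb X\\ \mathbb Y\end{bmatrix},\qquad \mathbb X=\begin{bmatrix}(L^{+})_{v_n} & -(L^{+})_{v_n}(\mathbf 1_{n-1}\otimes I_s)\end{bmatrix},\qquad \mathbb Y=-(\mathbf 1_{n-1}^T\otimes I_s)\,\mathbb X .$$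
   Context: Laplacian: for a tree on $n$ vertices with $s\times s$ matrix edge weights $W(e)$, $L=[l_{uv}]_{u,v\in V}$ is the $ns\times ns$ block matrix whose $s\times s$ blocks are: for $u\ne v$, $l_{uv}=-W(e)$ if $u,v$ are joined by the edge $e$, and $l_{uv}=\mathbf 0$ if $u,v$ are not adjacent; $l_{vv}$ is the sum of the weights of the edges incident with $v$. When the weights are nonsingular, $L_v$ is invertible for every $v$. The rows and columns of $L^+$ are partitioned into $s\times s$ blocks indexed by $V$ in the same way as $L$. $I_k$ is the identity, $J_k$ the $k\times k$ all-ones matrix, $\mathbf 1_k$ the all-ones column vector of length $k$, and $A\otimes B=[a_{ij}B]$ is the Kronecker product. *)

theory Defs
  imports
    "Jordan_Normal_Form.Gauss_Jordan_Elimination"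
    "Jordan_Normal_Form.DL_Submatrix"
begin

section \<open>Trees\<close>

text \<open>A finite simple graph is a finite vertex set together with a set of two-element
  sets of vertices (the edges).\<close>

definition simple_graph :: "'a set \<Rightarrow> 'a set set \<Rightarrow> bool" where
  "simple_graph V E \<longleftrightarrow> finite V \<and> (\<forall>e\<in>E. \<exists>u\<in>V. \<exists>v\<in>V. u \<noteq> v \<and> e = {u, v})"

definition connected_graph :: "'a set \<Rightarrow> 'a set set \<Rightarrow> bool" where
  "connected_graph V E \<longleftrightarrow>
     V \<noteq> {} \<and> (\<forall>u\<in>V. \<forall>v\<in>V. (u, v) \<in> {(x, y). {x, y} \<in> E}\<^sup>*)"

definition graph_cycle :: "'a set set \<Rightarrow> 'a list \<Rightarrow> bool" where
  "graph_cycle E p \<longleftrightarrow>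
     3 \<le> length p \<and> distinct p \<and>
     (\<forall>i<length p. {p ! i, p ! (Suc i mod length p)} \<in> E)"

definition is_tree :: "'a set \<Rightarrow> 'a set set \<Rightarrow> bool" where
  "is_tree V E \<longleftrightarrow> simple_graph V E \<and> connected_graph V E \<and> (\<nexists>p. graph_cycle E p)"

section \<open>The Laplacian matrix for matrix edge weights\<close>

text \<open>The sum of the weights on the diagonal is taken entrywise, because the type of matrices
  of arbitrary dimension is not an additive monoid.\<close>

definition laplacian_block ::
  "'a set set \<Rightarrow> ('a set \<Rightarrow> real mat) \<Rightarrow> nat \<Rightarrow> 'a \<Rightarrow> 'a \<Rightarrow> real mat" where
  "laplacian_block E W s u v =
     (if u = v then mat s s (\<lambda>(i, j). \<Sum>e | e \<in> E \<and> v \<in> e. W e $$ (i, j))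
      else if {u, v} \<in> E then - W {u, v}
      else 0\<^sub>m s s)"

text \<open>The list \<open>vs\<close> fixes the ordering of the vertices: row (column) \<open>i\<close> of a block matrix
  belongs to the block of the vertex \<open>vs ! (i div s)\<close>.\<close>

definition laplacian ::
  "'a set set \<Rightarrow> ('a set \<Rightarrow> real mat) \<Rightarrow> nat \<Rightarrow> 'a list \<Rightarrow> real mat" where
  "laplacian E W s vs =
     mat (length vs * s) (length vs * s)
       (\<lambda>(i, j). laplacian_block E W s (vs ! (i div s)) (vs ! (j div s)) $$ (i mod s, j mod s))"

definition delete_vertex_block :: "'a list \<Rightarrow> nat \<Rightarrow> 'a \<Rightarrow> 'b mat \<Rightarrow> 'b mat" where
  "delete_vertex_block vs s v A =
     (let I = {i. i < length vs * s \<and> vs ! (i div s) \<noteq> v} in submatrix A I I)"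

section \<open>Matrix operations\<close>

text \<open>The Moore--Penrose inverse of a real matrix is the unique matrix satisfying the four
  Penrose equations.\<close>

definition is_moore_penrose_inverse :: "real mat \<Rightarrow> real mat \<Rightarrow> bool" where
  "is_moore_penrose_inverse A X \<longleftrightarrow>
     X \<in> carrier_mat (dim_col A) (dim_row A) \<and>
     A * X * A = A \<and> X * A * X = X \<and>
     transpose_mat (A * X) = A * X \<and> transpose_mat (X * A) = X * A"

definition moore_penrose_inverse :: "real mat \<Rightarrow> real mat" where
  "moore_penrose_inverse A = (THE X. is_moore_penrose_inverse A X)"

definition kronecker_product :: "'a::times mat \<Rightarrow> 'a mat \<Rightarrow> 'a mat"
    (infixl \<open>\<otimes>\<^sub>K\<close> 75) where
  "A \<otimes>\<^sub>K B =
     mat (dim_row A * dim_row B) (dim_col A * dim_col B)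
       (\<lambda>(i, j). A $$ (i div dim_row B, j div dim_col B) * B $$ (i mod dim_row B, j mod dim_col B))"

definition ones_mat :: "nat \<Rightarrow> nat \<Rightarrow> 'a::one mat" where
  "ones_mat r c = mat r c (\<lambda>_. 1)"

definition append_cols :: "'a::zero mat \<Rightarrow> 'a mat \<Rightarrow> 'a mat" (infixr \<open>@\<^sub>c\<close> 65) where
  "A @\<^sub>c B = four_block_mat A B (0\<^sub>m 0 (dim_col A)) (0\<^sub>m 0 (dim_col B))"

end

theory Submission
  imports Defs "Jordan_Normal_Form.Determinant"
begin

text \<open>
  The block rows and the block columns of the Laplacian \<open>L\<close> sum to zero, so the block row and the
  block column of a vertex \<open>v\<close> can be recovered from \<open>L\<^sub>v\<close>: with \<open>B\<close> the matrix that restores a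
  deleted block as minus the sum of the others (\<open>contrast_mat\<close>), one has \<open>L = B L\<^sub>v B\<^sup>T\<close>
  (\<open>contrast_mat_congruence\<close>). The Gram matrix \<open>B\<^sup>T B = I + J \<otimes> I\<close> has the inverse \<open>M\<close>
  (\<open>gram_mult_centering\<close>). If \<open>L\<^sub>v\<close> is invertible, this is a full-rank factorization, and the
  Penrose equations give \<open>L\<^sup>+ = B (M L\<^sub>v\<^sup>-\<^sup>1 M) B\<^sup>T\<close> (\<open>moore_penrose_inverse_factorization\<close>). Deleting
  the block of \<open>v\<close> from such a product leaves the middle factor, which is the first claim. For the
  last vertex, \<open>B\<close> is the identity on top of \<open>-(1\<^sup>T \<otimes> I)\<close>, and multiplying out \<open>B (L\<^sup>+)\<^sub>v B\<^sup>T\<close> is the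
  second claim.

  The tree enters only through the invertibility of \<open>L\<^sub>v\<close>. The weights are arbitrary nonsingular
  matrices, so \<open>L\<close> need not be symmetric or semidefinite and no energy argument applies. Instead, for
  a vector \<open>x\<close> in the kernel of \<open>L\<close>, the quantities \<open>W {u, w} (x u - x w)\<close> form a flow along the
  edges that is conserved at every vertex. Each edge of a tree is a bridge, so it is the only edge
  out of one side, and its flow must vanish (\<open>conservative_flow_eq_0\<close>). Hence \<open>x\<close> takes the same
  value at all vertices (\<open>laplacian_kernel_constant\<close>). A vector annihilated by \<open>L\<^sub>v\<close> lifts through \<open>B\<close>
  to the kernel of \<open>L\<close>, and \<open>B\<^sup>T\<close> sends constants to zero (\<open>reduced_laplacian_kernel_trivial\<close>).
\<close>

section \<open>Conservative flows on trees\<close>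

lemma rtrancl_imp_distinct_walk:
  assumes "(a, b) \<in> r\<^sup>*"
  shows "\<exists>p. p \<noteq> [] \<and> distinct p \<and> hd p = a \<and> last p = b \<and>
             (\<forall>i. Suc i < length p \<longrightarrow> (p ! i, p ! Suc i) \<in> r)"
  using assms
proof (induction rule: rtrancl_induct)
  case base
  show ?case by (intro exI[of _ "[a]"]) simp
next
  case (step y z)
  then obtain p where p: "p \<noteq> []" "distinct p" "hd p = a" "last p = y"
    "\<And>i. Suc i < length p \<Longrightarrow> (p ! i, p ! Suc i) \<in> r" by blast
  show ?case
  proof (cases "z \<in> set p")
    case True
    then obtain k where k: "k < length p" "p ! k = z" by (auto simp: in_set_conv_nth)
    let ?q = "take (Suc k) p"
    have "last ?q = z" using k p(1) by (simp add: take_Suc_conv_app_nth)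
    then show ?thesis using k p by (intro exI[of _ ?q]) auto
  next
    case False
    have "((p @ [z]) ! i, (p @ [z]) ! Suc i) \<in> r" if "Suc i < length (p @ [z])" for i
    proof (cases "Suc i < length p")
      case True
      then show ?thesis using p(5)[of i] by (simp add: nth_append)
    next
      case False
      then have "i = length p - 1" using that p(1) by simp
      then show ?thesis using step.hyps p(1,4) by (simp add: nth_append last_conv_nth)
    qed
    then show ?thesis using p False by (intro exI[of _ "p @ [z]"]) (simp add: hd_append)
  qed
qed

text \<open>A second way from \<open>a\<close> to \<open>b\<close> would contain one without repetitions; as it avoids the edge
  \<open>{a, b}\<close>, it has at least three vertices, and the edge closes it to a cycle.\<close>

lemma acyclic_edge_is_bridge:
  assumes acyc: "\<nexists>p. graph_cycle E p" and e: "{a, b} \<in> E" and ne: "a \<noteq> b"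
  shows "(a, b) \<notin> {(x, y). {x, y} \<in> E - {{a, b}}}\<^sup>*"
proof
  assume "(a, b) \<in> {(x, y). {x, y} \<in> E - {{a, b}}}\<^sup>*"
  from rtrancl_imp_distinct_walk[OF this] obtain p where p: "p \<noteq> []" "distinct p" "hd p = a" "last p = b"
    and st: "\<And>i. Suc i < length p \<Longrightarrow> {p ! i, p ! Suc i} \<in> E \<and> {p ! i, p ! Suc i} \<noteq> {a, b}" by blast
  have hd: "p ! 0 = a" and la: "p ! (length p - 1) = b"
    using p by (simp_all add: hd_conv_nth last_conv_nth)
  have "length p \<noteq> 1" using hd la ne by auto
  moreover have "length p \<noteq> 2" using hd la st[of 0] by (auto simp: eval_nat_numeral)
  ultimately have len: "3 \<le> length p" using p(1) by (cases "length p") auto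
  have "{p ! i, p ! (Suc i mod length p)} \<in> E" if "i < length p" for i
  proof (cases "Suc i < length p")
    case True
    then show ?thesis using st[of i] by simp
  next
    case False
    then have "Suc i = length p" using that by simp
    moreover from this have "i = length p - 1" by simp
    ultimately show ?thesis using hd la e by (simp add: insert_commute)
  qed
  then have "graph_cycle E p" using len p(2) by (simp add: graph_cycle_def)
  with acyc show False by blast
qed

lemma sum_antisymmetric_eq_0:
  fixes f :: "'a \<Rightarrow> 'a \<Rightarrow> real"
  assumes "\<And>u w. f u w = - f w u"
  shows "(\<Sum>u\<in>A. \<Sum>w\<in>A. f u w) = 0"
proof -
  have "(\<Sum>u\<in>A. \<Sum>w\<in>A. f u w) = (\<Sum>w\<in>A. \<Sum>u\<in>A. f u w)" by (rule sum.swap)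
  also have "\<dots> = - (\<Sum>u\<in>A. \<Sum>w\<in>A. f u w)"
    by (simp add: sum_negf[symmetric] assms[symmetric])
  finally show ?thesis by simp
qed

text \<open>Let \<open>A\<close> be the side of \<open>a\<close> after removal of the edge \<open>{a, b}\<close>. Summing the net outflow over
  \<open>A\<close>, the contributions inside \<open>A\<close> cancel by antisymmetry, and \<open>{a, b}\<close> is the only edge that
  leaves \<open>A\<close>, so that what remains is \<open>F a b\<close>. No sign enters here, which is why the argument
  serves weights that are neither positive nor symmetric.\<close>

lemma conservative_flow_eq_0:
  fixes F :: "'a \<Rightarrow> 'a \<Rightarrow> real"
  assumes graph: "simple_graph V E" and acyc: "\<nexists>p. graph_cycle E p"
    and anti: "\<And>u w. F u w = - F w u"
    and cons: "\<And>u. u \<in> V \<Longrightarrow> (\<Sum>w | {u, w} \<in> E. F u w) = 0"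
    and e: "{a, b} \<in> E"
  shows "F a b = 0"
proof (cases "a = b")
  case True
  then show ?thesis using anti[of a a] by simp
next
  case False
  have fin: "finite V" using graph by (simp add: simple_graph_def)
  have EV: "u \<in> V \<and> w \<in> V" if "{u, w} \<in> E" for u w
    using graph that unfolding simple_graph_def by (metis doubleton_eq_iff)
  define A where "A = {u. (a, u) \<in> {(x, y). {x, y} \<in> E - {{a, b}}}\<^sup>*}"
  have aA: "a \<in> A" by (simp add: A_def)
  have bA: "b \<notin> A" using acyclic_edge_is_bridge[OF acyc e False] by (simp add: A_def)
  have clos: "{u, w} = {a, b}" if "u \<in> A" "w \<notin> A" "{u, w} \<in> E" for u w
  proof (rule ccontr)
    assume "{u, w} \<noteq> {a, b}"
    then have "(u, w) \<in> {(x, y). {x, y} \<in> E - {{a, b}}}" using that(3) by simp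
    with that(1) have "w \<in> A" unfolding A_def by (auto intro: rtrancl_into_rtrancl)
    with that(2) show False by simp
  qed
  have AV: "A \<subseteq> V"
  proof
    fix u assume "u \<in> A"
    then have "(a, u) \<in> {(x, y). {x, y} \<in> E - {{a, b}}}\<^sup>*" by (simp add: A_def)
    then show "u \<in> V"
      using EV[OF e] EV by (cases rule: rtranclE) auto
  qed
  define G where "G u w = (if {u, w} \<in> E then F u w else 0)" for u w
  have nbr: "(\<Sum>w | {u, w} \<in> E. F u w) = (\<Sum>w\<in>A. G u w) + (\<Sum>w\<in>V - A. G u w)" for u
  proof -
    have "(\<Sum>w | {u, w} \<in> E. F u w) = (\<Sum>w\<in>V. G u w)"
      unfolding G_def using EV
      by (intro sum.mono_neutral_cong_left) (auto simp: fin)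
    also have "\<dots> = (\<Sum>w\<in>A. G u w) + (\<Sum>w\<in>V - A. G u w)"
      using sum.subset_diff[OF AV fin, of "G u"] by simp
    finally show ?thesis .
  qed
  have "(\<Sum>u\<in>A. \<Sum>w | {u, w} \<in> E. F u w) = 0" using AV cons by (intro sum.neutral) auto
  then have "0 = (\<Sum>u\<in>A. \<Sum>w\<in>A. G u w) + (\<Sum>u\<in>A. \<Sum>w\<in>V - A. G u w)"
    by (simp add: nbr sum.distrib)
  also have "(\<Sum>u\<in>A. \<Sum>w\<in>A. G u w) = 0"
    proof (rule sum_antisymmetric_eq_0)
    show "G u w = - G w u" for u w using anti[of u w] by (simp add: G_def insert_commute)
  qed
  also have "(\<Sum>u\<in>A. \<Sum>w\<in>V - A. G u w) =
      (\<Sum>u\<in>A. \<Sum>w\<in>V - A. if w = b then if u = a then F a b else 0 else 0)"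
  proof (intro sum.cong refl)
    fix u w assume "u \<in> A" "w \<in> V - A"
    then show "G u w = (if w = b then if u = a then F a b else 0 else 0)"
      using clos[of u w] bA aA e by (auto simp: G_def doubleton_eq_iff)
  qed
  also have "\<dots> = F a b"
    using fin finite_subset[OF AV fin] aA bA EV[OF e] by simp
  finally show ?thesis by simp
qed

section \<open>The Laplacian of a tree with matrix weights\<close>

lemma simple_graph_edge_endpoints:
  assumes "simple_graph V E" "{u, w} \<in> E"
  shows "u \<in> V" "w \<in> V" "u \<noteq> w"
proof -
  from assms obtain a b where "a \<in> V" "b \<in> V" "a \<noteq> b" "{u, w} = {a, b}"
    unfolding simple_graph_def by blast
  then show "u \<in> V" "w \<in> V" "u \<noteq> w" by (auto simp: doubleton_eq_iff)
qed

lemma laplacian_block_diagonal: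
  assumes "simple_graph V E" "t < s" "q < s"
  shows "laplacian_block E W s u u $$ (t, q) = (\<Sum>w | {u, w} \<in> E. W {u, w} $$ (t, q))"
proof -
  have "\<exists>w. e = {u, w}" if "e \<in> E" "u \<in> e" for e
  proof -
    have "\<exists>a\<in>V. \<exists>b\<in>V. a \<noteq> b \<and> e = {a, b}"
      using assms(1) that(1) by (simp add: simple_graph_def)
    then obtain a b where ab: "e = {a, b}" by (elim bexE conjE)
    with that(2) consider "u = a" | "u = b" by blast
    then show ?thesis using ab by cases (auto intro: exI[of _ a] exI[of _ b])
  qed
  then have "{e \<in> E. u \<in> e} = (\<lambda>w. {u, w}) ` {w. {u, w} \<in> E}" by (auto simp: image_iff)
  moreover have "inj_on (\<lambda>w. {u, w}) {w. {u, w} \<in> E}"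
    by (auto intro!: inj_onI simp: doubleton_eq_iff)
  ultimately show ?thesis
    using assms(2,3) by (simp add: laplacian_block_def sum.reindex)
qed

lemma laplacian_block_sym: "laplacian_block E W s u w = laplacian_block E W s w u"
  by (simp add: laplacian_block_def insert_commute)

text \<open>The Laplacian acts by weighted differences along edges. The argument \<open>y\<close> is a scalar per vertex
  so that the lemma gives two facts at once: a constant \<open>y\<close> yields the zero block row sums, and
  summing over \<open>q\<close> yields the action of \<open>L\<close> on vectors.\<close>

lemma laplacian_block_sum:
  assumes graph: "simple_graph V E" and carr: "\<And>e. e \<in> E \<Longrightarrow> W e \<in> carrier_mat s s"
    and u: "u \<in> V" and t: "t < s" and q: "q < s"
  shows "(\<Sum>w\<in>V. laplacian_block E W s u w $$ (t, q) * y w) =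
         (\<Sum>w | {u, w} \<in> E. W {u, w} $$ (t, q) * (y u - y w))"
proof -
  let ?N = "{w. {u, w} \<in> E}"
  let ?l = "\<lambda>w. laplacian_block E W s u w $$ (t, q)"
  have fin: "finite V" using graph by (simp add: simple_graph_def)
  note ends = simple_graph_edge_endpoints[OF graph]
  have "(\<Sum>w\<in>V. ?l w * y w) = ?l u * y u + (\<Sum>w\<in>V - {u}. ?l w * y w)"
    using fin u by (simp add: sum.remove)
  also have "(\<Sum>w\<in>V - {u}. ?l w * y w) = (\<Sum>w\<in>?N. - (W {u, w} $$ (t, q)) * y w)"
  proof (rule sum.mono_neutral_cong_right)
    show "finite (V - {u})" using fin by simp
    show "?N \<subseteq> V - {u}" using ends by blast
    show "\<forall>w\<in>V - {u} - ?N. ?l w * y w = 0" using t q by (auto simp: laplacian_block_def)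
    fix w assume "w \<in> ?N"
    then show "?l w * y w = - (W {u, w} $$ (t, q)) * y w"
      using ends[of u w] carr[of "{u, w}"] t q by (auto simp: laplacian_block_def)
  qed
  also have "?l u * y u + \<dots> = (\<Sum>w\<in>?N. W {u, w} $$ (t, q) * (y u - y w))"
    by (simp add: laplacian_block_diagonal[OF graph t q] sum_distrib_right right_diff_distrib
        sum_subtractf sum_negf)
  finally show ?thesis .
qed

lemma invertible_mat_kernel_trivial:
  fixes A :: "'a :: comm_ring_1 mat"
  assumes A: "A \<in> carrier_mat s s" and inv: "invertible_mat A"
    and zero: "\<And>t. t < s \<Longrightarrow> (\<Sum>q<s. A $$ (t, q) * y q) = 0" and q: "q < s"
  shows "y q = 0"
proof -
  obtain B where "A * B = 1\<^sub>m (dim_row A)" and BA: "B * A = 1\<^sub>m (dim_row B)"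
    using inv by (auto simp: invertible_mat_def inverts_mat_def)
  have "dim_col (B * A) = dim_row B" by (simp add: BA)
  moreover have "dim_col (A * B) = s" using A \<open>A * B = _\<close> by simp
  ultimately have B: "B \<in> carrier_mat s s" using A by auto
  have Ay: "A *\<^sub>v vec s y = 0\<^sub>v s"
    by (rule eq_vecI) (use A zero in \<open>auto simp: scalar_prod_def lessThan_atLeast0\<close>)
  have "vec s y = (B * A) *\<^sub>v vec s y" using B by (simp add: BA)
  also have "\<dots> = B *\<^sub>v (A *\<^sub>v vec s y)" by (rule assoc_mult_mat_vec[OF B A]) simp
  also have "\<dots> = 0\<^sub>v s" using B Ay by auto
  finally show ?thesis using q by (metis index_vec index_zero_vec(1))
qed

text \<open>For \<open>x\<close> in the kernel of \<open>L\<close>, every component of \<open>W {u, w} (x u - x w)\<close> is a conservative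
  flow, hence zero. A nonsingular weight then forces \<open>x u = x w\<close> across each edge, and
  connectedness carries the equality to all vertices.\<close>

lemma laplacian_kernel_constant:
  assumes tree: "is_tree V E"
    and W: "\<And>e. e \<in> E \<Longrightarrow> W e \<in> carrier_mat s s \<and> invertible_mat (W e)"
    and zero: "\<And>u t. u \<in> V \<Longrightarrow> t < s \<Longrightarrow>
                 (\<Sum>w\<in>V. \<Sum>q<s. laplacian_block E W s u w $$ (t, q) * x w q) = 0"
    and u: "u \<in> V" and w: "w \<in> V" and q: "q < s"
  shows "x u q = x w q"
proof -
  have graph: "simple_graph V E" and conn: "connected_graph V E" and acyc: "\<nexists>p. graph_cycle E p"
    using tree by (auto simp: is_tree_def)
  define F where "F t u w = (\<Sum>q<s. W {u, w} $$ (t, q) * (x u q - x w q))" for t u w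
  have anti: "F t u w = - F t w u" for t u w
    by (simp add: F_def sum_negf[symmetric] insert_commute right_diff_distrib)
  have cons: "(\<Sum>w | {u, w} \<in> E. F t u w) = 0" if "u \<in> V" "t < s" for u t
  proof -
    have "(\<Sum>w | {u, w} \<in> E. F t u w) =
        (\<Sum>q<s. \<Sum>w | {u, w} \<in> E. W {u, w} $$ (t, q) * (x u q - x w q))"
      unfolding F_def by (rule sum.swap)
    also have "\<dots> = (\<Sum>q<s. \<Sum>w\<in>V. laplacian_block E W s u w $$ (t, q) * x w q)"
    proof (rule sum.cong[OF refl])
      fix q assume "q \<in> {..<s}"
      then show "(\<Sum>w | {u, w} \<in> E. W {u, w} $$ (t, q) * (x u q - x w q)) =
          (\<Sum>w\<in>V. laplacian_block E W s u w $$ (t, q) * x w q)"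
        using laplacian_block_sum[OF graph conjunct1[OF W] that, where q = q and y = "\<lambda>w. x w q"]
        by simp
    qed
    also have "\<dots> = (\<Sum>w\<in>V. \<Sum>q<s. laplacian_block E W s u w $$ (t, q) * x w q)"
      by (rule sum.swap)
    finally show ?thesis using zero[OF that] by simp
  qed
  have edge: "x a q = x b q" if e: "{a, b} \<in> E" for a b
  proof -
    have "F t a b = 0" if "t < s" for t
      by (rule conservative_flow_eq_0[OF graph acyc anti cons[OF _ that] e])
    then have "x a q - x b q = 0"
      using invertible_mat_kernel_trivial[of "W {a, b}" s "\<lambda>q. x a q - x b q"] W[OF e] q
      by (simp add: F_def)
    then show ?thesis by simp
  qed
  have "(u, w) \<in> {(x, y). {x, y} \<in> E}\<^sup>*" using conn u w by (simp add: connected_graph_def)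
  then show ?thesis by (induction rule: rtrancl_induct) (use edge in auto)
qed

lemma block_index:
  fixes i t s n :: nat
  assumes "i < n" "t < s"
  shows "i * s + t < n * s" "(i * s + t) div s = i" "(i * s + t) mod s = t"
proof -
  have "i * s + t < Suc i * s" using assms by simp
  also have "\<dots> \<le> n * s" using assms by (intro mult_le_mono1) simp
  finally show "i * s + t < n * s" .
qed (use assms in simp_all)

lemma block_index_inv:
  fixes a s n :: nat
  assumes "a < n * s"
  shows "a div s < n" "a mod s < s" "a div s * s + a mod s = a"
proof -
  have "0 < s" using assms by (cases s) auto
  then show "a div s < n" "a mod s < s" "a div s * s + a mod s = a"
    using assms by (simp_all add: less_mult_imp_div_less)
qed

lemma sum_blocks:
  fixes f :: "nat \<Rightarrow> 'b :: comm_monoid_add"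
  shows "(\<Sum>a<n * s. f a) = (\<Sum>i<n. \<Sum>t<s. f (i * s + t))"
proof -
  have "(\<Sum>a<n * s. f a) = (\<Sum>i<n. sum f {i * s..<i * s + s})"
    by (rule sum.nat_group[symmetric])
  also have "\<dots> = (\<Sum>i<n. \<Sum>t<s. f (i * s + t))"
  proof (rule sum.cong[OF refl])
    show "sum f {i * s..<i * s + s} = (\<Sum>t<s. f (i * s + t))" for i
      using sum.shift_bounds_nat_ivl[of f 0 "i * s" s]
      by (simp only: lessThan_atLeast0 add.commute add_0_left add_0_right)
  qed
  finally show ?thesis .
qed

lemma laplacian_carrier: "laplacian E W s vs \<in> carrier_mat (length vs * s) (length vs * s)"
  by (simp add: laplacian_def)

lemma laplacian_index:
  assumes "i < length vs" "j < length vs" "t < s" "q < s"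
  shows "laplacian E W s vs $$ (i * s + t, j * s + q) =
         laplacian_block E W s (vs ! i) (vs ! j) $$ (t, q)"
  using assms by (simp add: laplacian_def block_index)

lemma laplacian_row_sums:
  assumes graph: "simple_graph (set vs) E" and dist: "distinct vs"
    and carr: "\<And>e. e \<in> E \<Longrightarrow> W e \<in> carrier_mat s s"
    and a: "a < length vs * s" and q: "q < s"
  shows "(\<Sum>j<length vs. laplacian E W s vs $$ (a, j * s + q)) = 0"
proof -
  note ai = block_index_inv[OF a]
  have "(\<Sum>j<length vs. laplacian E W s vs $$ (a div s * s + a mod s, j * s + q)) =
      (\<Sum>j<length vs. laplacian_block E W s (vs ! (a div s)) (vs ! j) $$ (a mod s, q))"
    using ai q by (intro sum.cong refl laplacian_index) auto
  also have "\<dots> = (\<Sum>w\<in>set vs. laplacian_block E W s (vs ! (a div s)) w $$ (a mod s, q))"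
    by (rule sum.reindex_bij_betw) (use dist in \<open>simp add: bij_betw_nth\<close>)
  also have "\<dots> = 0"
    using laplacian_block_sum[where W = W and s = s, OF graph carr,
        where u = "vs ! (a div s)" and t = "a mod s" and q = q
        and y = "\<lambda>_. 1"] ai q by simp
  finally show ?thesis by (simp only: ai)
qed

text \<open>The block at \<open>(u, w)\<close> equals the block at \<open>(w, u)\<close> even where the weights are not symmetric
  matrices; column sums thereby reduce to row sums.\<close>

lemma laplacian_block_transpose:
  assumes "i < length vs" "b < length vs * s" "t < s"
  shows "laplacian E W s vs $$ (i * s + t, b) =
         laplacian E W s vs $$ (b div s * s + t, i * s + b mod s)"
proof -
  note b = block_index_inv[OF assms(2)]
  have "laplacian E W s vs $$ (i * s + t, b div s * s + b mod s) =
      laplacian_block E W s (vs ! i) (vs ! (b div s)) $$ (t, b mod s)"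
    by (rule laplacian_index[OF assms(1) b(1) assms(3) b(2)])
  also have "\<dots> = laplacian_block E W s (vs ! (b div s)) (vs ! i) $$ (t, b mod s)"
    by (subst laplacian_block_sym) (rule refl)
  also have "\<dots> = laplacian E W s vs $$ (b div s * s + t, i * s + b mod s)"
    by (rule laplacian_index[OF b(1) assms(1) assms(3) b(2), symmetric])
  finally show ?thesis by (simp only: b(3))
qed

lemma laplacian_column_sums:
  assumes graph: "simple_graph (set vs) E" and dist: "distinct vs"
    and carr: "\<And>e. e \<in> E \<Longrightarrow> W e \<in> carrier_mat s s"
    and b: "b < length vs * s" and t: "t < s"
  shows "(\<Sum>i<length vs. laplacian E W s vs $$ (i * s + t, b)) = 0"
proof -
  note bi = block_index_inv[OF b]
  have "(\<Sum>i<length vs. laplacian E W s vs $$ (i * s + t, b)) =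
      (\<Sum>i<length vs. laplacian E W s vs $$ (b div s * s + t, i * s + b mod s))"
    using b t by (intro sum.cong refl laplacian_block_transpose) auto
  also have "\<dots> = 0"
    by (rule laplacian_row_sums[OF graph dist carr block_index(1)[OF bi(1) t] bi(2)])
  finally show ?thesis .
qed

lemma mult_mat_vec_index:
  assumes "A \<in> carrier_mat r c" "z \<in> carrier_vec c" "i < r"
  shows "(A *\<^sub>v z) $ i = (\<Sum>j<c. A $$ (i, j) * z $ j)"
  using assms by (auto simp: scalar_prod_def lessThan_atLeast0 intro!: sum.cong)

lemma laplacian_kernel:
  assumes tree: "is_tree (set vs) E" and dist: "distinct vs"
    and W: "\<And>e. e \<in> E \<Longrightarrow> W e \<in> carrier_mat s s \<and> invertible_mat (W e)"
    and z: "z \<in> carrier_vec (length vs * s)"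
    and zero: "laplacian E W s vs *\<^sub>v z = 0\<^sub>v (length vs * s)"
    and i: "i < length vs" and j: "j < length vs" and q: "q < s"
  shows "z $ (i * s + q) = z $ (j * s + q)"
proof -
  let ?n = "length vs"
  have bij: "bij_betw ((!) vs) {..<?n} (set vs)" using dist by (simp add: bij_betw_nth)
  \<comment> \<open>The kernel statement on vertices needs \<open>z\<close> as a function of vertices rather than positions.\<close>
  define pos where "pos = the_inv_into {..<?n} ((!) vs)"
  have pos: "pos (vs ! i) = i" if "i < ?n" for i
    unfolding pos_def using bij that by (intro the_inv_into_f_f) (auto simp: bij_betw_def)
  define x where "x w q = z $ (pos w * s + q)" for w q
  have "x (vs ! i) q = x (vs ! j) q"
  proof (rule laplacian_kernel_constant[OF tree W, where x = x])
    fix u t assume "u \<in> set vs" and t: "t < s"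
    then obtain k where k: "k < ?n" "u = vs ! k" by (auto simp: in_set_conv_nth)
    have "(\<Sum>w\<in>set vs. \<Sum>q<s. laplacian_block E W s u w $$ (t, q) * x w q) =
        (\<Sum>l<?n. \<Sum>q<s. laplacian_block E W s u (vs ! l) $$ (t, q) * x (vs ! l) q)"
      by (rule sum.reindex_bij_betw[OF bij, symmetric])
    also have "\<dots> = (\<Sum>l<?n. \<Sum>q<s. laplacian E W s vs $$ (k * s + t, l * s + q) * z $ (l * s + q))"
      using k t by (intro sum.cong refl) (simp add: laplacian_index x_def pos)
    also have "\<dots> = (\<Sum>b<?n * s. laplacian E W s vs $$ (k * s + t, b) * z $ b)"
      by (rule sum_blocks[symmetric])
    also have "\<dots> = (laplacian E W s vs *\<^sub>v z) $ (k * s + t)"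
      using block_index(1)[OF k(1) t]
      by (rule mult_mat_vec_index[OF laplacian_carrier z, symmetric])
    finally show "(\<Sum>w\<in>set vs. \<Sum>q<s. laplacian_block E W s u w $$ (t, q) * x w q) = 0"
      using block_index(1)[OF k(1) t] by (simp add: zero)
  qed (use i j q in auto)
  then show ?thesis using i j by (simp add: x_def pos)
qed

section \<open>Moore--Penrose inverses of full-rank factorizations\<close>

lemma moore_penrose_inverse_unique:
  assumes X: "is_moore_penrose_inverse A X" and Y: "is_moore_penrose_inverse A Y"
  shows "X = Y"
proof -
  obtain r c where A: "A \<in> carrier_mat r c" by auto
  have cX: "X \<in> carrier_mat c r" and cY: "Y \<in> carrier_mat c r"
    using X Y A by (auto simp: is_moore_penrose_inverse_def)
  have eX: "A * X * A = A" "X * A * X = X" "transpose_mat (A * X) = A * X" "transpose_mat (X * A) = X * A"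
    and eY: "A * Y * A = A" "Y * A * Y = Y" "transpose_mat (A * Y) = A * Y" "transpose_mat (Y * A) = Y * A"
    using X Y by (auto simp: is_moore_penrose_inverse_def)
  have AX: "A * X \<in> carrier_mat r r" and AY: "A * Y \<in> carrier_mat r r"
    and XA: "X * A \<in> carrier_mat c c" and YA: "Y * A \<in> carrier_mat c c" using A cX cY by auto
  \<comment> \<open>Each of \<open>A X\<close> and \<open>A Y\<close> is a product of the two, in opposite orders; as all are symmetric,
    transposition identifies them, and \<open>X A\<close>, \<open>Y A\<close> are treated alike.\<close>
  have "A * X = A * Y * A * X" by (simp add: eY)
  also have "\<dots> = (A * Y) * (A * X)" using assoc_mult_mat[OF AY A cX] .
  finally have 1: "A * X = (A * Y) * (A * X)" .
  have "A * Y = A * X * A * Y" by (simp add: eX)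
  also have "\<dots> = (A * X) * (A * Y)" using assoc_mult_mat[OF AX A cY] .
  also have "transpose_mat \<dots> = (A * Y) * (A * X)"
    by (simp add: transpose_mult[OF AX AY] eX eY)
  finally have AXY: "A * X = A * Y" using 1 eY(3) by simp
  have "X * A = X * (A * Y * A)" by (simp add: eY)
  also have "\<dots> = (X * A) * (Y * A)"
    by (simp add: assoc_mult_mat[OF A cY A] assoc_mult_mat[OF cX A YA])
  finally have 2: "X * A = (X * A) * (Y * A)" .
  have "Y * A = Y * (A * X * A)" by (simp add: eX)
  also have "\<dots> = (Y * A) * (X * A)"
    by (simp add: assoc_mult_mat[OF A cX A] assoc_mult_mat[OF cY A XA])
  also have "transpose_mat \<dots> = (X * A) * (Y * A)"
    by (simp add: transpose_mult[OF YA XA] eX eY)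
  finally have XYA: "X * A = Y * A" using 2 eY(4) by simp
  have "X = Y * A * X" using eX(2) XYA by simp
  also have "\<dots> = Y * A * Y"
    by (simp add: assoc_mult_mat[OF cY A cX] assoc_mult_mat[OF cY A cY] AXY)
  finally show ?thesis using eY(2) by simp
qed

lemma moore_penrose_inverse_eqI:
  "is_moore_penrose_inverse A X \<Longrightarrow> moore_penrose_inverse A = X"
  unfolding moore_penrose_inverse_def
  by (rule the_equality) (auto intro: moore_penrose_inverse_unique)

lemma congruence_mult:
  fixes B :: "real mat"
  assumes B: "B \<in> carrier_mat r m" and P: "P \<in> carrier_mat m m" and Q: "Q \<in> carrier_mat m m"
  shows "(B * P * transpose_mat B) * (B * Q * transpose_mat B) =
         B * (P * (transpose_mat B * B) * Q) * transpose_mat B"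
proof -
  let ?T = "transpose_mat B"
  have T: "?T \<in> carrier_mat m r" using B by simp
  note BP = mult_carrier_mat[OF B P] and BQ = mult_carrier_mat[OF B Q]
    and G = mult_carrier_mat[OF T B]
  note PG = mult_carrier_mat[OF P G] and GQ = mult_carrier_mat[OF G Q]
  have "(B * P * ?T) * (B * Q * ?T) = B * P * (?T * (B * Q * ?T))"
    by (rule assoc_mult_mat[OF BP T mult_carrier_mat[OF BQ T]])
  also have "?T * (B * Q * ?T) = ?T * B * Q * ?T"
    by (simp only: assoc_mult_mat[OF T BQ T, symmetric] assoc_mult_mat[OF T B Q, symmetric])
  also have "B * P * (?T * B * Q * ?T) = B * P * (?T * B * Q) * ?T"
    by (rule assoc_mult_mat[OF BP GQ T, symmetric])
  also have "B * P * (?T * B * Q) = B * (P * (?T * B) * Q)"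
    by (simp only: assoc_mult_mat[OF B P GQ] assoc_mult_mat[OF P G Q])
  finally show ?thesis .
qed

text \<open>With \<open>G = transpose_mat B * B\<close> and \<open>M\<close> its inverse, the product of \<open>B C B\<^sup>T\<close> and the proposed
  inverse is \<open>B M B\<^sup>T\<close> in either order, because \<open>C G (M D M) = M = (M D M) G C\<close>. This matrix is
  symmetric and idempotent (the orthogonal projection onto the column space of \<open>B\<close>), and the four
  Penrose equations follow.\<close>

lemma moore_penrose_inverse_factorization:
  fixes B :: "real mat"
  assumes B: "B \<in> carrier_mat r m"
    and C: "C \<in> carrier_mat m m" and D: "D \<in> carrier_mat m m" and M: "M \<in> carrier_mat m m"
    and CD: "C * D = 1\<^sub>m m" and DC: "D * C = 1\<^sub>m m"
    and GM: "transpose_mat B * B * M = 1\<^sub>m m" and MG: "M * (transpose_mat B * B) = 1\<^sub>m m"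
    and sym: "transpose_mat M = M"
  shows "moore_penrose_inverse (B * C * transpose_mat B) = B * (M * D * M) * transpose_mat B"
proof (rule moore_penrose_inverse_eqI)
  let ?T = "transpose_mat B" and ?E = "M * D * M"
  define G where "G = ?T * B"
  have G: "G \<in> carrier_mat m m" and T: "?T \<in> carrier_mat m r" using B by (auto simp: G_def)
  have MD: "M * D \<in> carrier_mat m m" and E: "?E \<in> carrier_mat m m" using M D by auto
  have gm: "G * M = 1\<^sub>m m" and mg: "M * G = 1\<^sub>m m" using GM MG by (simp_all add: G_def)
  have GE: "G * ?E = D * M"
    using assoc_mult_mat[OF G MD M] assoc_mult_mat[OF G M D] gm D M by simp
  have EG: "?E * G = M * D"
    using assoc_mult_mat[OF MD M G] mg MD M D by simp
  have "C * G * ?E = C * (D * M)" using assoc_mult_mat[OF C G E] GE by simp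
  also have "\<dots> = M" using assoc_mult_mat[OF C D M] CD M by simp
  finally have CGE: "C * G * ?E = M" .
  have EGC: "?E * G * C = M" using assoc_mult_mat[OF M D C] DC EG M by simp
  have MGC: "M * G * C = C" and MGE: "M * G * ?E = ?E"
    by (simp_all only: mg left_mult_one_mat[OF C] left_mult_one_mat[OF E])
  have AX: "(B * C * ?T) * (B * ?E * ?T) = B * M * ?T"
    using congruence_mult[OF B C E] CGE by (simp add: G_def)
  have XA: "(B * ?E * ?T) * (B * C * ?T) = B * M * ?T"
    using congruence_mult[OF B E C] EGC by (simp add: G_def)
  have AXA: "(B * M * ?T) * (B * C * ?T) = B * C * ?T"
    using congruence_mult[OF B M C] MGC by (simp add: G_def)
  have XAX: "(B * M * ?T) * (B * ?E * ?T) = B * ?E * ?T"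
    using congruence_mult[OF B M E] MGE by (simp add: G_def)
  have "transpose_mat (B * M * ?T) = transpose_mat ?T * transpose_mat (B * M)"
    by (rule transpose_mult[of _ r m _ r]) (use B M T in simp_all)
  also have "\<dots> = B * (M * ?T)" by (simp only: transpose_mult[OF B M] sym transpose_transpose)
  finally have "transpose_mat (B * M * ?T) = B * M * ?T"
    using assoc_mult_mat[OF B M T] by simp
  moreover have "dim_row (B * C * ?T) = r" "dim_col (B * C * ?T) = r" using B by simp_all
  moreover have "B * ?E * ?T \<in> carrier_mat r r"
    by (rule mult_carrier_mat[OF mult_carrier_mat[OF B E] T])
  ultimately show "is_moore_penrose_inverse (B * C * ?T) (B * ?E * ?T)"
    unfolding is_moore_penrose_inverse_def by (simp only: AX XA AXA XAX)
qed

section \<open>Deleting one block and restoring it\<close>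

text \<open>The position in the full index range of the index \<open>j\<close> of the range from which block \<open>k\<close> has been
  removed.\<close>

definition skip_block :: "nat \<Rightarrow> nat \<Rightarrow> nat \<Rightarrow> nat" where
  "skip_block s k j = (if j < k * s then j else j + s)"

lemma skip_block_mod [simp]: "skip_block s k j mod s = j mod s"
  by (simp add: skip_block_def)

lemma skip_block_div:
  assumes "0 < s"
  shows "skip_block s k j div s = (if j div s < k then j div s else Suc (j div s))"
  using assms by (simp add: skip_block_def div_less_iff_less_mult)

lemma skip_block_less:
  assumes "j < (n - 1) * s"
  shows "skip_block s k j < n * s"
  using assms by (cases n) (auto simp: skip_block_def)

lemma skip_block_strict_mono: "strict_mono (skip_block s k)"
  by (auto simp: strict_mono_def skip_block_def)

lemma skip_block_eq_iff [simp]: "skip_block s k i = skip_block s k j \<longleftrightarrow> i = j"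
  using skip_block_strict_mono[of s k] by (metis strict_mono_eq)

lemma skip_block_image:
  assumes "k < n"
  shows "skip_block s k ` {..<(n - 1) * s} = {a. a < n * s \<and> a div s \<noteq> k}"
proof (intro equalityI subsetI)
  fix a assume "a \<in> skip_block s k ` {..<(n - 1) * s}"
  then obtain j where j: "j < (n - 1) * s" "a = skip_block s k j" by auto
  then have "0 < s" by (cases s) auto
  with j show "a \<in> {a. a < n * s \<and> a div s \<noteq> k}"
    by (simp add: skip_block_less skip_block_div)
next
  fix a assume "a \<in> {a. a < n * s \<and> a div s \<noteq> k}"
  then have a: "a < n * s" "a div s \<noteq> k" by auto
  then have s: "0 < s" by (cases s) auto
  show "a \<in> skip_block s k ` {..<(n - 1) * s}"
  proof (cases "a div s < k")
    case True
    then have "a < k * s" using s by (simp add: div_less_iff_less_mult)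
    moreover have "k * s \<le> (n - 1) * s" using assms by (intro mult_le_mono1) simp
    ultimately have "a = skip_block s k a" "a < (n - 1) * s"
      by (simp_all only: skip_block_def if_True)
    then show ?thesis by blast
  next
    case False
    then have "Suc k \<le> a div s" using a(2) by simp
    then have "Suc k * s \<le> a" using s by (simp add: less_eq_div_iff_mult_less_eq del: mult_Suc)
    moreover have "n * s = (n - 1) * s + s" using assms by (cases n) auto
    ultimately show ?thesis using a(1)
      by (intro image_eqI[of _ _ "a - s"]) (auto simp: skip_block_def)
  qed
qed

text \<open>Connects the recursively defined enumeration behind submatrices with an explicit one.\<close>

lemma pick_enumeration:
  assumes f: "strict_mono f" and im: "f ` {..<m} = I" and j: "j < m"
  shows "pick I j = f j"
proof -
  have "{a \<in> I. a < f j} = f ` {..<j}"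
    using f j by (auto simp: im[symmetric] strict_mono_less)
  then have "card {a \<in> I. a < f j} = j"
    using f by (simp add: card_image strict_mono_imp_inj_on)
  moreover have "f j \<in> I" using im j by auto
  ultimately show ?thesis using pick_card_in_set[of "f j" I] by simp
qed

lemma delete_vertex_block_eq:
  assumes A: "A \<in> carrier_mat (n * s) (n * s)" and vs: "distinct vs" "length vs = n" and k: "k < n"
  shows "delete_vertex_block vs s (vs ! k) A =
         mat ((n - 1) * s) ((n - 1) * s) (\<lambda>(i, j). A $$ (skip_block s k i, skip_block s k j))"
proof -
  define I where "I = {a. a < n * s \<and> a div s \<noteq> k}"
  have im: "skip_block s k ` {..<(n - 1) * s} = I" unfolding I_def by (rule skip_block_image[OF k])
  have "{i. i < length vs * s \<and> vs ! (i div s) \<noteq> vs ! k} = I"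
    using vs k by (auto simp: I_def nth_eq_iff_index_eq block_index_inv)
  moreover have "card I = (n - 1) * s"
    unfolding im[symmetric] by (subst card_image) (auto simp: inj_on_def)
  moreover have "{a. a < n * s \<and> a \<in> I} = I" by (auto simp: I_def)
  ultimately show ?thesis
    using A pick_enumeration[OF skip_block_strict_mono im]
    by (auto simp: delete_vertex_block_def submatrix_def intro!: eq_matI)
qed

text \<open>Multiplication by this matrix puts back a deleted block row \<open>k\<close> as minus the sum of the others;
  its transpose subtracts the block \<open>k\<close> from every other block. For \<open>k = n - 1\<close> it is the identity on
  top of \<open>-(1\<^sup>T \<otimes> I)\<close>. Each column is a difference of two unit vectors, so a product with the
  transpose on the left reads off a difference of two rows.\<close>

definition contrast_mat :: "nat \<Rightarrow> nat \<Rightarrow> nat \<Rightarrow> real mat" where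
  "contrast_mat n s k = mat (n * s) ((n - 1) * s)
     (\<lambda>(a, j). of_bool (a = skip_block s k j) - of_bool (a = k * s + j mod s))"

lemma contrast_mat_carrier: "contrast_mat n s k \<in> carrier_mat (n * s) ((n - 1) * s)"
  by (simp add: contrast_mat_def)

(* Simplification turns n - 1 into n - Suc 0, so the rewrite rule has to be in that form. *)
declare contrast_mat_carrier [unfolded One_nat_def, simp]

lemma mult_mat_index:
  assumes "A \<in> carrier_mat r m" "B \<in> carrier_mat m c" "i < r" "j < c"
  shows "(A * B) $$ (i, j) = (\<Sum>p<m. A $$ (i, p) * B $$ (p, j))"
  using assms by (auto simp: scalar_prod_def lessThan_atLeast0 intro!: sum.cong)

lemma block_index_mod_less:
  fixes j s n k :: nat
  assumes "j < (n - 1) * s" "k < n"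
  shows "k * s + j mod s < n * s" "0 < s"
proof -
  show "0 < s" using assms by (cases s) auto
  then show "k * s + j mod s < n * s" using assms by (intro block_index) auto
qed

lemma sum_of_bool_eq:
  fixes f :: "nat \<Rightarrow> real"
  assumes "c < m"
  shows "(\<Sum>a<m. of_bool (a = c) * f a) = f c" "(\<Sum>a<m. of_bool (c = a) * f a) = f c"
  using assms by (simp_all add: of_bool_def if_distrib[of "\<lambda>x. x * _"] cong: if_cong)

lemma transpose_contrast_mat_mult_vec:
  assumes z: "z \<in> carrier_vec (n * s)" and j: "j < (n - 1) * s" and k: "k < n"
  shows "(transpose_mat (contrast_mat n s k) *\<^sub>v z) $ j = z $ skip_block s k j - z $ (k * s + j mod s)"
proof -
  have "(transpose_mat (contrast_mat n s k) *\<^sub>v z) $ j =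
      (\<Sum>a<n * s. transpose_mat (contrast_mat n s k) $$ (j, a) * z $ a)"
    by (rule mult_mat_vec_index[OF _ z j]) simp
  also have "\<dots> = (\<Sum>a<n * s. of_bool (a = skip_block s k j) * z $ a - of_bool (a = k * s + j mod s) * z $ a)"
    using j by (intro sum.cong refl) (simp add: contrast_mat_def left_diff_distrib)
  finally show ?thesis
    using skip_block_less[OF j] block_index_mod_less[OF j k]
    by (simp only: sum_subtractf sum_of_bool_eq)
qed

lemma contrast_mat_index_kept:
  assumes "i < (n - 1) * s" "j < (n - 1) * s" "k < n"
  shows "contrast_mat n s k $$ (skip_block s k i, j) = of_bool (i = j)"
proof -
  have s: "0 < s" by (rule block_index_mod_less[OF assms(1,3)])
  have "skip_block s k i div s \<noteq> k" using skip_block_image[OF assms(3)] assms(1) by blast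
  then have "skip_block s k i \<noteq> k * s + j mod s" using s by auto
  then show ?thesis using assms by (simp add: contrast_mat_def skip_block_less)
qed

lemma contrast_mat_index_deleted:
  assumes "t < s" "j < (n - 1) * s" "k < n"
  shows "contrast_mat n s k $$ (k * s + t, j) = - of_bool (t = j mod s)"
proof -
  have "skip_block s k j div s \<noteq> k" using skip_block_image[OF assms(3)] assms(2) by blast
  then have "k * s + t \<noteq> skip_block s k j" using block_index(2)[OF assms(3,1)] by auto
  then show ?thesis using assms block_index(1)[OF assms(3,1)] by (simp add: contrast_mat_def)
qed

lemma contrast_mat_mult_kept:
  assumes Z: "Z \<in> carrier_mat ((n - 1) * s) c" and i: "i < (n - 1) * s" and b: "b < c" and k: "k < n"
  shows "(contrast_mat n s k * Z) $$ (skip_block s k i, b) = Z $$ (i, b)"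
  using mult_mat_index[OF contrast_mat_carrier Z skip_block_less[OF i] b] i k
  by (simp add: contrast_mat_index_kept sum_of_bool_eq)

lemma contrast_mat_mult_deleted:
  assumes Z: "Z \<in> carrier_mat ((n - 1) * s) c" and t: "t < s" and b: "b < c" and k: "k < n"
  shows "(contrast_mat n s k * Z) $$ (k * s + t, b) =
         - (\<Sum>j<(n - 1) * s. of_bool (t = j mod s) * Z $$ (j, b))"
  using mult_mat_index[OF contrast_mat_carrier Z block_index(1)[OF k t] b] t k
  by (simp add: contrast_mat_index_deleted sum_negf)

lemma sum_residue_class:
  fixes f :: "nat \<Rightarrow> real"
  assumes "t < s"
  shows "(\<Sum>a<n * s. of_bool (t = a mod s) * f a) = (\<Sum>u<n. f (u * s + t))"
  using assms by (simp add: sum_blocks sum_of_bool_eq)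

lemma sum_skip_block:
  fixes f :: "nat \<Rightarrow> real"
  assumes k: "k < n" and t: "t < s"
  shows "(\<Sum>j<(n - 1) * s. of_bool (t = j mod s) * f (skip_block s k j)) =
         (\<Sum>u<n. f (u * s + t)) - f (k * s + t)"
proof -
  let ?g = "\<lambda>a. of_bool (t = a mod s) * f a"
  let ?I = "{a. a < n * s \<and> a div s \<noteq> k}" and ?K = "{a. a < n * s \<and> a div s = k}"
  have "(\<Sum>j<(n - 1) * s. of_bool (t = j mod s) * f (skip_block s k j)) =
      (\<Sum>j<(n - 1) * s. ?g (skip_block s k j))" by simp
  also have "\<dots> = sum ?g ?I"
    unfolding skip_block_image[OF k, symmetric] by (subst sum.reindex) (auto simp: inj_on_def)
  finally have 1: "(\<Sum>j<(n - 1) * s. of_bool (t = j mod s) * f (skip_block s k j)) = sum ?g ?I" .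
  have "sum ?g ?K = sum ?g {k * s + t}"
    using block_index[OF k t] by (intro sum.mono_neutral_right) (auto simp: of_bool_def)
  then have 2: "sum ?g ?K = f (k * s + t)" using t by simp
  have "{..<n * s} = ?I \<union> ?K" by auto
  then have "(\<Sum>a<n * s. ?g a) = sum ?g ?I + sum ?g ?K"
    by (simp only:) (intro sum.union_disjoint, auto)
  then show ?thesis using 1 2 by (simp add: sum_residue_class[OF t])
qed

lemma contrast_mat_restore:
  assumes A: "A \<in> carrier_mat (n * s) c" and k: "k < n"
    and zero: "\<And>t b. t < s \<Longrightarrow> b < c \<Longrightarrow> (\<Sum>u<n. A $$ (u * s + t, b)) = 0"
  shows "contrast_mat n s k * mat ((n - 1) * s) c (\<lambda>(j, b). A $$ (skip_block s k j, b)) = A"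
    (is "_ * ?Z = A")
proof (rule eq_matI)
  have Z: "?Z \<in> carrier_mat ((n - 1) * s) c" by simp
  fix a b assume "a < dim_row A" "b < dim_col A"
  then have a: "a < n * s" and b: "b < c" using A by auto
  show "(contrast_mat n s k * ?Z) $$ (a, b) = A $$ (a, b)"
  proof (cases "a div s = k")
    case True
    then have a_eq: "a = k * s + a mod s" and t: "a mod s < s"
      using block_index_inv[OF a] by auto
    have "(contrast_mat n s k * ?Z) $$ (k * s + a mod s, b) =
        - (\<Sum>j<(n - 1) * s. of_bool (a mod s = j mod s) * A $$ (skip_block s k j, b))"
      using contrast_mat_mult_deleted[OF Z t b k] b by simp
    also have "\<dots> = A $$ (k * s + a mod s, b)"
      using sum_skip_block[OF k t, of "\<lambda>a. A $$ (a, b)"] zero[OF t b] by simp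
    finally show ?thesis using a_eq by simp
  next
    case False
    then obtain i where "i < (n - 1) * s" "a = skip_block s k i"
      using skip_block_image[OF k] a by blast
    then show ?thesis using contrast_mat_mult_kept[OF Z _ b k] b by simp
  qed
qed (use A in \<open>auto simp: contrast_mat_def\<close>)

text \<open>A matrix with vanishing block row sums and block column sums is determined by any principal
  submatrix that omits one block: first the rows are restored, then, after transposing, the
  columns.\<close>

lemma contrast_mat_congruence:
  assumes A: "A \<in> carrier_mat (n * s) (n * s)" and k: "k < n"
    and cols: "\<And>t b. t < s \<Longrightarrow> b < n * s \<Longrightarrow> (\<Sum>u<n. A $$ (u * s + t, b)) = 0"
    and rows: "\<And>t a. t < s \<Longrightarrow> a < n * s \<Longrightarrow> (\<Sum>u<n. A $$ (a, u * s + t)) = 0"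
  shows "A = contrast_mat n s k *
      mat ((n - 1) * s) ((n - 1) * s) (\<lambda>(i, j). A $$ (skip_block s k i, skip_block s k j)) *
      transpose_mat (contrast_mat n s k)"
proof -
  let ?B = "contrast_mat n s k" and ?m = "(n - 1) * s"
  let ?Z = "mat ?m (n * s) (\<lambda>(j, b). A $$ (skip_block s k j, b))"
  let ?C = "mat ?m ?m (\<lambda>(i, j). A $$ (skip_block s k i, skip_block s k j))"
  have ZT: "transpose_mat ?Z \<in> carrier_mat (n * s) ?m" by simp
  have "?B * mat ?m ?m (\<lambda>(j, b). transpose_mat ?Z $$ (skip_block s k j, b)) = transpose_mat ?Z"
  proof (rule contrast_mat_restore[OF ZT k])
    fix t b assume "t < s" "b < ?m"
    then show "(\<Sum>u<n. transpose_mat ?Z $$ (u * s + t, b)) = 0"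
      using rows[OF _ skip_block_less] by (simp add: block_index)
  qed
  also have "mat ?m ?m (\<lambda>(j, b). transpose_mat ?Z $$ (skip_block s k j, b)) = transpose_mat ?C"
    by (rule eq_matI) (simp_all add: skip_block_less)
  finally have "transpose_mat (?B * transpose_mat ?C) = transpose_mat (transpose_mat ?Z)" by simp
  then have "?Z = ?C * transpose_mat ?B"
    by (subst (asm) transpose_mult[of _ "n * s" ?m _ ?m]) simp_all
  then have "A = ?B * (?C * transpose_mat ?B)"
    using contrast_mat_restore[OF A k cols] by simp
  also have "\<dots> = ?B * ?C * transpose_mat ?B"
    by (rule assoc_mult_mat[symmetric, of _ "n * s" ?m _ ?m _ "n * s"]) simp_all
  finally show ?thesis .
qed

lemma contrast_mat_congruence_mult_index:
  assumes C: "C \<in> carrier_mat ((n - 1) * s) ((n - 1) * s)" and k: "k < n"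
    and i: "i < (n - 1) * s" and j: "j < (n - 1) * s"
  shows "(contrast_mat n s k * C * transpose_mat (contrast_mat n s k)) $$
           (skip_block s k i, skip_block s k j) = C $$ (i, j)"
proof -
  let ?B = "contrast_mat n s k" and ?m = "(n - 1) * s"
  have T: "transpose_mat ?B \<in> carrier_mat ?m (n * s)" and CT: "transpose_mat C \<in> carrier_mat ?m ?m"
    using C by simp_all
  have "C * transpose_mat ?B = transpose_mat (?B * transpose_mat C)"
    by (simp only: transpose_mult[OF contrast_mat_carrier CT] transpose_transpose)
  moreover have "(?B * (C * transpose_mat ?B)) $$ (skip_block s k i, skip_block s k j) =
      (C * transpose_mat ?B) $$ (i, skip_block s k j)"
    by (rule contrast_mat_mult_kept[OF mult_carrier_mat[OF C T] i skip_block_less[OF j] k])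
  ultimately have "(?B * C * transpose_mat ?B) $$ (skip_block s k i, skip_block s k j) =
      transpose_mat (?B * transpose_mat C) $$ (i, skip_block s k j)"
    by (simp only: assoc_mult_mat[OF contrast_mat_carrier C T])
  also have "\<dots> = (?B * transpose_mat C) $$ (skip_block s k j, i)"
    using C i skip_block_less[OF j] by (simp add: contrast_mat_def)
  also have "\<dots> = C $$ (i, j)"
    using contrast_mat_mult_kept[OF CT j i k] C i j by simp
  finally show ?thesis .
qed

section \<open>The Moore--Penrose inverse of the Laplacian\<close>

lemma contrast_mat_gram:
  assumes k: "k < n"
  shows "transpose_mat (contrast_mat n s k) * contrast_mat n s k =
         mat ((n - 1) * s) ((n - 1) * s) (\<lambda>(i, j). of_bool (i = j) + of_bool (i mod s = j mod s))"
proof (rule eq_matI)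
  let ?B = "contrast_mat n s k" and ?m = "(n - 1) * s"
  have d: "dim_row ?B = n * s" "dim_col ?B = ?m" by (simp_all add: contrast_mat_def)
  fix i j assume "i < dim_row (mat ?m ?m (\<lambda>(i, j). of_bool (i = j) + of_bool (i mod s = j mod s) :: real))"
    "j < dim_col (mat ?m ?m (\<lambda>(i, j). of_bool (i = j) + of_bool (i mod s = j mod s) :: real))"
  then have i: "i < ?m" and j: "j < ?m" by auto
  have im: "i mod s < s" using block_index_mod_less[OF i k] by simp
  have "(transpose_mat ?B * ?B) $$ (i, j) = (transpose_mat ?B *\<^sub>v col ?B j) $ i"
    using i j by (simp add: d)
  also have "\<dots> = col ?B j $ skip_block s k i - col ?B j $ (k * s + i mod s)"
    by (rule transpose_contrast_mat_mult_vec[OF _ i k]) (use col_dim[of ?B j] in \<open>simp only: d\<close>)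
  also have "\<dots> = of_bool (i = j) + of_bool (i mod s = j mod s)"
    using contrast_mat_index_kept[OF i j k] contrast_mat_index_deleted[OF im j k]
      skip_block_less[OF i, of k] block_index_mod_less[OF i k] j
    by (simp add: d)
  finally show "(transpose_mat ?B * ?B) $$ (i, j) =
      mat ?m ?m (\<lambda>(i, j). of_bool (i = j) + of_bool (i mod s = j mod s)) $$ (i, j)"
    using i j by simp
qed (simp_all add: contrast_mat_def)

lemma centering_mat_eq:
  "1\<^sub>m (p * s) - ones_mat p p \<otimes>\<^sub>K ((1 / real n) \<cdot>\<^sub>m 1\<^sub>m s) =
   mat (p * s) (p * s) (\<lambda>(i, j). of_bool (i = j) - of_bool (i mod s = j mod s) / real n)"
  by (rule eq_matI)
    (auto simp: kronecker_product_def ones_mat_def block_index_inv)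

text \<open>The Gram matrix is \<open>I + J \<otimes> I\<close> with \<open>J\<close> of order \<open>n - 1\<close>, and
  \<open>(I + J)(I - J / n) = I + J - J / n - (n - 1) J / n = I\<close> since \<open>J J = (n - 1) J\<close>. As both factors
  are symmetric, the other order follows by transposition.\<close>

lemma gram_mult_centering:
  fixes s :: nat
  assumes k: "k < n"
  defines "M \<equiv> mat ((n - 1) * s) ((n - 1) * s)
                 (\<lambda>(i, j). of_bool (i = j) - of_bool (i mod s = j mod s) / real n)"
  shows "transpose_mat (contrast_mat n s k) * contrast_mat n s k * M = 1\<^sub>m ((n - 1) * s)" (is "?G * M = _")
    and "M * (transpose_mat (contrast_mat n s k) * contrast_mat n s k) = 1\<^sub>m ((n - 1) * s)"
    and "transpose_mat M = M"
proof -
  let ?m = "(n - 1) * s"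
  note G_eq = contrast_mat_gram[OF k, of s]
  have G: "?G \<in> carrier_mat ?m ?m" unfolding G_eq by simp
  have M: "M \<in> carrier_mat ?m ?m" by (simp add: M_def)
  have GT: "transpose_mat ?G = ?G" unfolding G_eq by (rule eq_matI) auto
  show MT: "transpose_mat M = M" unfolding M_def by (rule eq_matI) auto
  show GM: "?G * M = 1\<^sub>m ?m"
  proof (rule eq_matI)
    fix i j assume "i < dim_row (1\<^sub>m ?m :: real mat)" "j < dim_col (1\<^sub>m ?m :: real mat)"
    then have i: "i < ?m" and j: "j < ?m" by auto
    define h :: "nat \<Rightarrow> real" where "h p = of_bool (p = j) - of_bool (p mod s = j mod s) / real n" for p
    have im: "i mod s < s" using block_index_mod_less[OF i k] by simp
    have "(?G * M) $$ (i, j) = (\<Sum>p<?m. ?G $$ (i, p) * M $$ (p, j))"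
      by (rule mult_mat_index[OF G M i j])
    also have "\<dots> = (\<Sum>p<?m. of_bool (i = p) * h p + of_bool (i mod s = p mod s) * h p)"
      using i j by (intro sum.cong refl) (simp add: G_eq M_def h_def distrib_right)
    also have "\<dots> = h i + (\<Sum>p<?m. of_bool (i mod s = p mod s) * h p)"
      by (simp only: sum.distrib sum_of_bool_eq[OF i])
    also have "(\<Sum>p<?m. of_bool (i mod s = p mod s) * h p) =
        (\<Sum>p<?m. of_bool (p = j) * of_bool (i mod s = p mod s)) -
        (\<Sum>p<?m. of_bool (i mod s = p mod s) * (of_bool (p mod s = j mod s) / real n))"
      by (simp add: h_def right_diff_distrib sum_subtractf mult.commute)
    also have "(\<Sum>p<?m. of_bool (p = j) * of_bool (i mod s = p mod s)) =
        (of_bool (i mod s = j mod s) :: real)"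
      by (rule sum_of_bool_eq[OF j])
    also have "(\<Sum>p<?m. of_bool (i mod s = p mod s) * (of_bool (p mod s = j mod s) / real n)) =
        (real n - 1) * (of_bool (i mod s = j mod s) / real n)"
      using sum_residue_class[OF im, where n = "n - 1" and f = "\<lambda>p. of_bool (p mod s = j mod s) / real n"] k
      by (simp add: of_nat_diff)
    also have "h i + (of_bool (i mod s = j mod s) - (real n - 1) * (of_bool (i mod s = j mod s) / real n)) =
        of_bool (i = j)"
      using k by (simp add: h_def field_simps)
    finally show "(?G * M) $$ (i, j) = 1\<^sub>m ?m $$ (i, j)" using i j by simp
  qed (use G M in auto)
  have "transpose_mat (?G * M) = M * ?G" by (simp only: transpose_mult[OF G M] GT MT)
  then show "M * ?G = 1\<^sub>m ?m" by (simp add: GM)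
qed

lemma mat_inverse_trivial_kernel:
  fixes A :: "'a :: field mat"
  assumes A: "A \<in> carrier_mat m m"
    and ker: "\<And>z. z \<in> carrier_vec m \<Longrightarrow> A *\<^sub>v z = 0\<^sub>v m \<Longrightarrow> z = 0\<^sub>v m"
  shows "the (mat_inverse A) \<in> carrier_mat m m" "A * the (mat_inverse A) = 1\<^sub>m m"
    "the (mat_inverse A) * A = 1\<^sub>m m"
proof -
  have "det A \<noteq> 0" using det_0_iff_vec_prod_zero_field[OF A] ker by auto
  then have "mat_inverse A \<noteq> None"
    using det_non_zero_imp_unit[OF A, where b = "()"] mat_inverse(1)[OF A, where b = "()"] by blast
  then obtain D where "mat_inverse A = Some D" by auto
  with mat_inverse(2)[OF A this] show "the (mat_inverse A) \<in> carrier_mat m m"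
    "A * the (mat_inverse A) = 1\<^sub>m m" "the (mat_inverse A) * A = 1\<^sub>m m" by auto
qed

lemma mult_mat_zero_vec:
  fixes A :: "'a :: semiring_0 mat"
  assumes "A \<in> carrier_mat r c"
  shows "A *\<^sub>v 0\<^sub>v c = 0\<^sub>v r"
  using assms by auto

text \<open>Since \<open>M\<close> inverts the Gram matrix of \<open>B\<close>, the vector \<open>x = B M z\<close> satisfies \<open>B\<^sup>T x = z\<close>. If \<open>C z = 0\<close>,
  then \<open>L x = B C B\<^sup>T x = 0\<close>, so \<open>x\<close> has equal blocks; but \<open>B\<^sup>T x\<close> consists of differences of blocks,
  whence \<open>z = 0\<close>.\<close>

lemma reduced_laplacian_kernel_trivial:
  assumes tree: "is_tree (set vs) E" and dist: "distinct vs" and n: "length vs = n" and k: "k < n"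
    and W: "\<And>e. e \<in> E \<Longrightarrow> W e \<in> carrier_mat s s \<and> invertible_mat (W e)"
    and C: "C \<in> carrier_mat ((n - 1) * s) ((n - 1) * s)"
    and L: "laplacian E W s vs = contrast_mat n s k * C * transpose_mat (contrast_mat n s k)"
    and z: "z \<in> carrier_vec ((n - 1) * s)" and Cz: "C *\<^sub>v z = 0\<^sub>v ((n - 1) * s)"
  shows "z = 0\<^sub>v ((n - 1) * s)"
proof -
  let ?m = "(n - 1) * s" and ?B = "contrast_mat n s k"
  \<comment> \<open>The inverse of the Gram matrix of the contrast matrix.\<close>
  define M where "M = mat ?m ?m (\<lambda>(i, j). of_bool (i = j) - of_bool (i mod s = j mod s) / real n)"
  have B: "?B \<in> carrier_mat (n * s) ?m" and T: "transpose_mat ?B \<in> carrier_mat ?m (n * s)"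
    and M: "M \<in> carrier_mat ?m ?m" by (simp_all add: M_def)
  define x where "x = ?B *\<^sub>v (M *\<^sub>v z)"
  have Mz: "M *\<^sub>v z \<in> carrier_vec ?m" using M z by (rule mult_mat_vec_carrier)
  have x: "x \<in> carrier_vec (n * s)" unfolding x_def using B Mz by (rule mult_mat_vec_carrier)
  have "transpose_mat ?B *\<^sub>v x = (transpose_mat ?B * ?B) *\<^sub>v (M *\<^sub>v z)"
    unfolding x_def by (rule assoc_mult_mat_vec[OF T B Mz, symmetric])
  also have "\<dots> = (transpose_mat ?B * ?B * M) *\<^sub>v z"
    by (rule assoc_mult_mat_vec[OF mult_carrier_mat[OF T B] M z, symmetric])
  also have "\<dots> = z"
    using gram_mult_centering(1)[OF k, of s] z by (simp add: M_def)
  finally have Tx: "transpose_mat ?B *\<^sub>v x = z" .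
  note BC = mult_carrier_mat[OF B C]
  have "laplacian E W s vs *\<^sub>v x = ?B * C *\<^sub>v (transpose_mat ?B *\<^sub>v x)"
    unfolding L by (rule assoc_mult_mat_vec[OF BC T x])
  also have "\<dots> = ?B *\<^sub>v (C *\<^sub>v z)" unfolding Tx by (rule assoc_mult_mat_vec[OF B C z])
  also have "\<dots> = 0\<^sub>v (n * s)" 
    unfolding Cz by (rule mult_mat_zero_vec[OF B])
  finally have Lx: "laplacian E W s vs *\<^sub>v x = 0\<^sub>v (length vs * s)" using n by simp
  show ?thesis
  proof (rule eq_vecI)
    fix j assume "j < dim_vec (0\<^sub>v ?m :: real vec)"
    then have j: "j < ?m" by simp
    note sj = block_index_inv[OF skip_block_less[OF j, of k]]
    have "x $ (skip_block s k j div s * s + j mod s) = x $ (k * s + j mod s)"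
      by (rule laplacian_kernel[OF tree dist W _ Lx]) (use x n sj k in auto)
    then have "x $ skip_block s k j = x $ (k * s + j mod s)" using sj(3) by simp
    then have "(transpose_mat ?B *\<^sub>v x) $ j = 0"
      by (simp only: transpose_contrast_mat_mult_vec[OF x j k] diff_self)
    then show "z $ j = 0\<^sub>v ?m $ j" using j by (simp add: Tx)
  qed (use z in simp)
qed

lemma append_rows_index:
  assumes "A \<in> carrier_mat r c" "B \<in> carrier_mat q c" "j < c"
  shows "i < r \<Longrightarrow> (A @\<^sub>r B) $$ (i, j) = A $$ (i, j)"
    and "i < q \<Longrightarrow> (A @\<^sub>r B) $$ (r + i, j) = B $$ (i, j)"
  using assms by (simp_all add: append_rows_def)

lemma append_cols_index:
  assumes "A \<in> carrier_mat r c" "B \<in> carrier_mat r q" "i < r"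
  shows "j < c \<Longrightarrow> (A @\<^sub>c B) $$ (i, j) = A $$ (i, j)"
    and "j < q \<Longrightarrow> (A @\<^sub>c B) $$ (i, c + j) = B $$ (i, j)"
  using assms by (simp_all add: append_cols_def)

lemma carrier_append_cols:
  assumes "A \<in> carrier_mat r c" "B \<in> carrier_mat r q"
  shows "A @\<^sub>c B \<in> carrier_mat r (c + q)"
  using assms by (intro carrier_matI) (simp_all add: append_cols_def)

text \<open>Only for the last block does restoring a row amount to appending it.\<close>

lemma contrast_mat_last_mult:
  assumes Z: "Z \<in> carrier_mat ((n - 1) * s) c" and n: "0 < n"
  shows "contrast_mat n s (n - 1) * Z =
         Z @\<^sub>r (- (transpose_mat (ones_mat (n - 1) 1) \<otimes>\<^sub>K 1\<^sub>m s) * Z)"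
proof (rule eq_matI)
  let ?m = "(n - 1) * s" and ?R = "- (transpose_mat (ones_mat (n - 1) 1) \<otimes>\<^sub>K 1\<^sub>m s) :: real mat"
  have k: "n - 1 < n" using n by simp
  have R: "?R \<in> carrier_mat s ?m" by (simp add: kronecker_product_def ones_mat_def)
  have ns: "n * s = ?m + s" using n by (cases n) auto
  have RZ: "?R * Z \<in> carrier_mat s c" using R Z by simp
  have car: "Z @\<^sub>r (?R * Z) \<in> carrier_mat (n * s) c" unfolding ns using Z RZ by (rule carrier_append_rows)
  show "dim_row (contrast_mat n s (n - 1) * Z) = dim_row (Z @\<^sub>r (?R * Z))"
    "dim_col (contrast_mat n s (n - 1) * Z) = dim_col (Z @\<^sub>r (?R * Z))"
    using car Z by (simp_all add: contrast_mat_def)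
  fix a b assume "a < dim_row (Z @\<^sub>r (?R * Z))" "b < dim_col (Z @\<^sub>r (?R * Z))"
  then have a: "a < n * s" and b: "b < c" using car by auto
  show "(contrast_mat n s (n - 1) * Z) $$ (a, b) = (Z @\<^sub>r (?R * Z)) $$ (a, b)"
  proof (cases "a < ?m")
    case True
    have "(contrast_mat n s (n - 1) * Z) $$ (skip_block s (n - 1) a, b) = Z $$ (a, b)"
      by (rule contrast_mat_mult_kept[OF Z True b k])
    then show ?thesis
      by (simp only: append_rows_index(1)[OF Z RZ b True] skip_block_def True if_True)
  next
    case False
    define t where "t = a - ?m"
    have t: "t < s" "a = ?m + t" using False a ns by (auto simp: t_def)
    have "(contrast_mat n s (n - 1) * Z) $$ (?m + t, b) =
        - (\<Sum>j<?m. of_bool (t = j mod s) * Z $$ (j, b))"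
      by (rule contrast_mat_mult_deleted[OF Z t(1) b k])
    also have "\<dots> = (\<Sum>j<?m. ?R $$ (t, j) * Z $$ (j, b))"
      unfolding sum_negf[symmetric] using t(1)
      by (intro sum.cong refl) (auto simp: kronecker_product_def ones_mat_def block_index_inv)
    also have "\<dots> = (?R * Z) $$ (t, b)" by (rule mult_mat_index[OF R Z t(1) b, symmetric])
    also have "\<dots> = (Z @\<^sub>r (?R * Z)) $$ (?m + t, b)"
      by (rule append_rows_index(2)[OF Z RZ b t(1), symmetric])
    finally show ?thesis by (simp only: t(2))
  qed
qed

lemma mult_transpose_contrast_mat_last:
  assumes Z: "Z \<in> carrier_mat r ((n - 1) * s)" and n: "0 < n"
  shows "Z * transpose_mat (contrast_mat n s (n - 1)) =
         Z @\<^sub>c (- Z * (ones_mat (n - 1) 1 \<otimes>\<^sub>K 1\<^sub>m s))"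
proof (rule eq_matI)
  let ?m = "(n - 1) * s" and ?Q = "ones_mat (n - 1) 1 \<otimes>\<^sub>K 1\<^sub>m s :: real mat"
  let ?B = "contrast_mat n s (n - 1)"
  have k: "n - 1 < n" using n by simp
  have Q: "?Q \<in> carrier_mat ?m s" by (simp add: kronecker_product_def ones_mat_def)
  have ns: "n * s = ?m + s" using n by (cases n) auto
  have ZQ: "- Z * ?Q \<in> carrier_mat r s" using Q Z by simp
  have ZT: "transpose_mat Z \<in> carrier_mat ?m r" using Z by simp
  have T: "Z * transpose_mat ?B = transpose_mat (?B * transpose_mat Z)"
    by (simp only: transpose_mult[OF contrast_mat_carrier ZT] transpose_transpose)
  have BZ: "?B * transpose_mat Z \<in> carrier_mat (n * s) r"
    by (rule mult_carrier_mat[OF contrast_mat_carrier ZT])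
  have car: "Z @\<^sub>c (- Z * ?Q) \<in> carrier_mat r (n * s)"
    unfolding ns by (rule carrier_append_cols[OF Z ZQ])
  show "dim_row (Z * transpose_mat ?B) = dim_row (Z @\<^sub>c (- Z * ?Q))"
    "dim_col (Z * transpose_mat ?B) = dim_col (Z @\<^sub>c (- Z * ?Q))"
    using car Z by (simp_all only: index_mult_mat index_transpose_mat carrier_matD
        carrier_matD[OF contrast_mat_carrier])
  fix i a assume "i < dim_row (Z @\<^sub>c (- Z * ?Q))" "a < dim_col (Z @\<^sub>c (- Z * ?Q))"
  then have i: "i < r" and a: "a < n * s" by (simp_all only: carrier_matD[OF car])
  have "(Z * transpose_mat ?B) $$ (i, a) = (?B * transpose_mat Z) $$ (a, i)"
    unfolding T by (rule index_transpose_mat(1)) (simp_all only: carrier_matD[OF BZ] i a)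
  also have "\<dots> = (Z @\<^sub>c (- Z * ?Q)) $$ (i, a)"
  proof (cases "a < ?m")
    case True
    have "(?B * transpose_mat Z) $$ (skip_block s (n - 1) a, i) = transpose_mat Z $$ (a, i)"
      by (rule contrast_mat_mult_kept[OF ZT True i k])
    moreover have "transpose_mat Z $$ (a, i) = Z $$ (i, a)" using True Z i by simp
    ultimately show ?thesis
      by (simp only: append_cols_index(1)[OF Z ZQ i True] skip_block_def True if_True)
  next
    case False
    define t where "t = a - ?m"
    have t: "t < s" "a = ?m + t" using False a ns by (auto simp: t_def)
    have "(?B * transpose_mat Z) $$ (?m + t, i) =
        - (\<Sum>j<?m. of_bool (t = j mod s) * transpose_mat Z $$ (j, i))"
      by (rule contrast_mat_mult_deleted[OF ZT t(1) i k])
    also have "\<dots> = (\<Sum>j<?m. (- Z) $$ (i, j) * ?Q $$ (j, t))"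
      unfolding sum_negf[symmetric] using t(1) i Z
      by (intro sum.cong refl) (auto simp: kronecker_product_def ones_mat_def block_index_inv)
    also have "\<dots> = (- Z * ?Q) $$ (i, t)"
      by (rule mult_mat_index[symmetric, OF _ Q i t(1)]) (use Z in simp)
    also have "\<dots> = (Z @\<^sub>c (- Z * ?Q)) $$ (i, ?m + t)"
      by (rule append_cols_index(2)[OF Z ZQ i t(1), symmetric])
    finally show ?thesis by (simp only: t(2))
  qed
  finally show "(Z * transpose_mat ?B) $$ (i, a) = (Z @\<^sub>c (- Z * ?Q)) $$ (i, a)" .
qed

text \<open>Both claims of the theorem are read off from the middle factor: for \<open>P = M L\<^sub>v\<^sup>-\<^sup>1 M\<close>, the factorization lemma gives
  \<open>L\<^sup>+ = B P B\<^sup>T\<close>, and deleting the block of \<open>v\<close> from a matrix of the form \<open>B P B\<^sup>T\<close> leaves \<open>P\<close>.\<close>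

lemma moore_penrose_inverse_laplacian:
  assumes tree: "is_tree (set vs) E" and dist: "distinct vs" and n: "length vs = n" and k: "k < n"
    and W: "\<And>e. e \<in> E \<Longrightarrow> W e \<in> carrier_mat s s \<and> invertible_mat (W e)"
  defines "L \<equiv> laplacian E W s vs"
    and "M \<equiv> 1\<^sub>m ((n - 1) * s) - ones_mat (n - 1) (n - 1) \<otimes>\<^sub>K ((1 / real n) \<cdot>\<^sub>m 1\<^sub>m s)"
    and "B \<equiv> contrast_mat n s k"
  defines "P \<equiv> M * the (mat_inverse (delete_vertex_block vs s (vs ! k) L)) * M"
  shows "P \<in> carrier_mat ((n - 1) * s) ((n - 1) * s)"
    and "moore_penrose_inverse L = B * P * transpose_mat B"
    and "delete_vertex_block vs s (vs ! k) (moore_penrose_inverse L) = P"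
proof -
  let ?m = "(n - 1) * s"
  define C where "C = delete_vertex_block vs s (vs ! k) L"
  define D where "D = the (mat_inverse C)"
  have graph: "simple_graph (set vs) E" using tree by (simp add: is_tree_def)
  have L: "L \<in> carrier_mat (n * s) (n * s)"
    using laplacian_carrier[of E W s vs] n by (simp add: L_def)
  have C_eq: "C = mat ?m ?m (\<lambda>(i, j). L $$ (skip_block s k i, skip_block s k j))"
    unfolding C_def by (rule delete_vertex_block_eq[OF L dist n k])
  have C: "C \<in> carrier_mat ?m ?m" by (simp add: C_eq)
  have L_eq: "L = B * C * transpose_mat B"
    unfolding C_eq B_def
  proof (rule contrast_mat_congruence[OF L k])
    show "(\<Sum>u<n. L $$ (u * s + t, b)) = 0" if "t < s" "b < n * s" for t b
      using laplacian_column_sums[where W = W and s = s and b = b and t = t, OF graph dist conjunct1[OF W]] that n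
      by (simp add: L_def)
    show "(\<Sum>u<n. L $$ (a, u * s + t)) = 0" if "t < s" "a < n * s" for t a
      using laplacian_row_sums[where W = W and s = s and a = a and q = t, OF graph dist conjunct1[OF W]] that n
      by (simp add: L_def)
  qed
  have inv: "D \<in> carrier_mat ?m ?m" "C * D = 1\<^sub>m ?m" "D * C = 1\<^sub>m ?m"
    unfolding D_def
    using mat_inverse_trivial_kernel[OF C
        reduced_laplacian_kernel_trivial[OF tree dist n k W C L_eq[unfolded L_def B_def]]]
    by auto
  have M_eq: "M = mat ?m ?m (\<lambda>(i, j). of_bool (i = j) - of_bool (i mod s = j mod s) / real n)"
    unfolding M_def by (rule centering_mat_eq)
  have M: "M \<in> carrier_mat ?m ?m" by (simp add: M_eq)
  have P_eq: "P = M * D * M" by (simp add: P_def D_def C_def)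
  show P: "P \<in> carrier_mat ?m ?m" using M inv(1) by (simp add: P_eq)
  have B: "B \<in> carrier_mat (n * s) ?m" unfolding B_def by (rule contrast_mat_carrier)
  show Lp: "moore_penrose_inverse L = B * P * transpose_mat B"
    unfolding P_eq L_eq
    by (rule moore_penrose_inverse_factorization[OF B C inv(1) M inv(2,3)])
      (simp_all only: B_def M_eq gram_mult_centering[OF k])
  have "moore_penrose_inverse L \<in> carrier_mat (n * s) (n * s)"
    unfolding Lp using B P by simp
  then have "delete_vertex_block vs s (vs ! k) (moore_penrose_inverse L) =
      mat ?m ?m (\<lambda>(i, j). moore_penrose_inverse L $$ (skip_block s k i, skip_block s k j))"
    by (rule delete_vertex_block_eq[OF _ dist n k])
  also have "\<dots> = P"
    unfolding Lp B_def
    by (rule eq_matI)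
      (use P in \<open>simp_all add: contrast_mat_congruence_mult_index[OF P k, unfolded One_nat_def]\<close>)
  finally show "delete_vertex_block vs s (vs ! k) (moore_penrose_inverse L) = P" .
qed

theorem theorem2p9:
  fixes V :: "'a set" and E :: "'a set set" and W :: "'a set \<Rightarrow> real mat"
    and s n :: nat and vs :: "'a list" and L Lp M :: "real mat"
  assumes "is_tree V E"
    and "card V = n"
    and "\<And>e. e \<in> E \<Longrightarrow> W e \<in> carrier_mat s s \<and> invertible_mat (W e)"
    and "distinct vs" and "set vs = V"
    and "L = laplacian E W s vs"
    and "Lp = moore_penrose_inverse L"
    and "M = 1\<^sub>m ((n - 1) * s) - ones_mat (n - 1) (n - 1) \<otimes>\<^sub>K ((1 / real n) \<cdot>\<^sub>m 1\<^sub>m s)"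
  shows "(\<forall>v\<in>V. delete_vertex_block vs s v Lp =
            M * the (mat_inverse (delete_vertex_block vs s v L)) * M) \<and>
         (let Lpv = delete_vertex_block vs s (last vs) Lp;
              X = Lpv @\<^sub>c (- Lpv * (ones_mat (n - 1) 1 \<otimes>\<^sub>K 1\<^sub>m s));
              Y = - (transpose_mat (ones_mat (n - 1) 1) \<otimes>\<^sub>K 1\<^sub>m s) * X
          in Lp = X @\<^sub>r Y)"
proof
  have tree: "is_tree (set vs) E" and n: "length vs = n"
    using assms(1,2,4,5) distinct_card[of vs] by auto
  have "vs \<noteq> []" using tree by (auto simp: is_tree_def connected_graph_def)
  then have n0: "0 < n" and last: "last vs = vs ! (n - 1)" using n by (auto simp: last_conv_nth)
  note mp = moore_penrose_inverse_laplacian[where W = W and s = s, OF tree assms(4) n _ assms(3),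
      folded assms(6), folded assms(7,8)]
  show "\<forall>v\<in>V. delete_vertex_block vs s v Lp =
      M * the (mat_inverse (delete_vertex_block vs s v L)) * M"
  proof
    fix v assume "v \<in> V"
    then obtain k where "k < n" "v = vs ! k" using assms(5) n by (auto simp: in_set_conv_nth)
    then show "delete_vertex_block vs s v Lp =
        M * the (mat_inverse (delete_vertex_block vs s v L)) * M" using mp(3) by simp
  qed
  define Z where "Z = delete_vertex_block vs s (last vs) Lp"
  let ?B = "contrast_mat n s (n - 1)" and ?m = "(n - 1) * s"
  have k: "n - 1 < n" using n0 by simp
  have Z: "Z \<in> carrier_mat ?m ?m" and Lp: "Lp = ?B * Z * transpose_mat ?B"
    using mp[OF k] by (simp_all only: Z_def last)
  have T: "transpose_mat ?B \<in> carrier_mat ?m (n * s)" by simp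
  have "Lp = ?B * (Z * transpose_mat ?B)"
    unfolding Lp by (rule assoc_mult_mat[OF contrast_mat_carrier Z T])
  also have "\<dots> = (Z * transpose_mat ?B) @\<^sub>r
      (- (transpose_mat (ones_mat (n - 1) 1) \<otimes>\<^sub>K 1\<^sub>m s) * (Z * transpose_mat ?B))"
    by (rule contrast_mat_last_mult[OF mult_carrier_mat[OF Z T] n0])
  finally show "let Lpv = delete_vertex_block vs s (last vs) Lp;
              X = Lpv @\<^sub>c (- Lpv * (ones_mat (n - 1) 1 \<otimes>\<^sub>K 1\<^sub>m s));
              Y = - (transpose_mat (ones_mat (n - 1) 1) \<otimes>\<^sub>K 1\<^sub>m s) * X
          in Lp = X @\<^sub>r Y"
    unfolding Let_def Z_def[symmetric] mult_transpose_contrast_mat_last[OF Z n0] .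
qed

end
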